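(* Let $k$ be a field of characteristic zero, let $R$ be an integral domain containing $k$, let $n\ge 2$ and let $D\in\mathrm{LND}_R(R^{[n]})$, where $R^{[n]}$ is the polynomial ring in $n$ variables over $R$. If $D$ is triangular, then $\ker(D)$ is non-rigid.
   Context: For a domain $B\supset R\supset k$, $\mathrm{LND}_R(B)$ is the set of locally nilpotent derivations $D$ of $B$ with $R\subset\ker D$; a derivation $D$ is locally nilpotent if for every $b\in B$ there is a positive integer $m$ with $D^m(b)=0$. $D\in\mathrm{LND}_R(R^{[n]})$ is triangular if there is a coordinate system $\{X_1,\dots,X_n\}$ of $R^{[n]}$ over $R$ (that is, $R^{[n]}=R[X_1,\dots,X_n]$) such that $D(X_i)\in R[X_1,\dots,X_{i-1}]$ for $1\le i\le n$. A domain containing $k$ is rigid if it has no non-zero locally nilpotent derivation, and non-rigid otherwise. *)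

theory Defs
  imports "HOL-Library.Poly_Mapping" "HOL-Computational_Algebra.Polynomial"
begin

section \<open>Subrings of a commutative ring type\<close>

definition is_subring :: "'a::comm_ring_1 set \<Rightarrow> bool" where
  "is_subring A \<longleftrightarrow>
     1 \<in> A \<and> (\<forall>a\<in>A. \<forall>b\<in>A. a - b \<in> A) \<and> (\<forall>a\<in>A. \<forall>b\<in>A. a * b \<in> A)"

definition is_subfield :: "'a::comm_ring_1 set \<Rightarrow> bool" where
  "is_subfield K \<longleftrightarrow>
     is_subring K \<and> (0::'a) \<noteq> 1 \<and> (\<forall>a\<in>K. a \<noteq> 0 \<longrightarrow> (\<exists>b\<in>K. a * b = 1))"

text \<open>\<open>adjoin R S\<close> is \<open>R[S]\<close>, for a subring \<open>R\<close>.\<close>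

definition adjoin :: "'a::comm_ring_1 set \<Rightarrow> 'a set \<Rightarrow> 'a set" where
  "adjoin R S = is_subring hull (R \<union> S)"


section \<open>Locally nilpotent derivations\<close>

text \<open>
  Derivations of a subring \<open>A\<close> are functions on the ambient type of which only the values
  on \<open>A\<close> matter.
\<close>

definition derivation_on :: "'a::comm_ring_1 set \<Rightarrow> ('a \<Rightarrow> 'a) \<Rightarrow> bool" where
  "derivation_on A D \<longleftrightarrow>
     (\<forall>a\<in>A. D a \<in> A) \<and>
     (\<forall>a\<in>A. \<forall>b\<in>A. D (a + b) = D a + D b) \<and>
     (\<forall>a\<in>A. \<forall>b\<in>A. D (a * b) = a * D b + D a * b)"

definition LND :: "'a::comm_ring_1 set \<Rightarrow> ('a \<Rightarrow> 'a) set" where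
  "LND A = {D. derivation_on A D \<and> (\<forall>a\<in>A. \<exists>m>0. (D ^^ m) a = 0)}"

definition ker_on :: "'a::comm_ring_1 set \<Rightarrow> ('a \<Rightarrow> 'a) \<Rightarrow> 'a set" where
  "ker_on A D = {a \<in> A. D a = 0}"

definition LND_over :: "'a::comm_ring_1 set \<Rightarrow> 'a set \<Rightarrow> ('a \<Rightarrow> 'a) set" where
  "LND_over R A = {D \<in> LND A. R \<subseteq> ker_on A D}"

definition rigid :: "'a::comm_ring_1 set \<Rightarrow> bool" where
  "rigid A \<longleftrightarrow> (\<forall>D\<in>LND A. \<forall>a\<in>A. D a = 0)"


section \<open>Polynomial rings and triangular derivations\<close>

text \<open>
  Polynomials with coefficients in \<open>'r\<close> in variables indexed by \<open>nat\<close> are finitely supported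
  maps from monomials \<open>nat \<Rightarrow>\<^sub>0 nat\<close> to \<open>'r\<close>; multiplication of \<open>\<Rightarrow>\<^sub>0\<close> is convolution.
  The polynomial ring in \<open>n\<close> variables consists of those that involve only the variables
  with indices \<open>1, \<dots>, n\<close>.
\<close>

type_synonym 'r mpoly = "(nat \<Rightarrow>\<^sub>0 nat) \<Rightarrow>\<^sub>0 'r"

definition constants :: "'r::comm_ring_1 mpoly set" where
  "constants = (\<lambda>c. Poly_Mapping.single 0 c) ` UNIV"

definition polyring :: "nat \<Rightarrow> 'r::comm_ring_1 mpoly set" where
  "polyring n = {p. \<forall>m \<in> Poly_Mapping.keys p. Poly_Mapping.keys m \<subseteq> {1..n}}"

text \<open>
  Algebraic independence of the \<open>X i\<close> is not demanded separately: \<open>n\<close> generators of a polynomial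
  ring in \<open>n\<close> variables over a domain are always algebraically independent.
\<close>

definition coordinate_system :: "nat \<Rightarrow> (nat \<Rightarrow> 'r::comm_ring_1 mpoly) \<Rightarrow> bool" where
  "coordinate_system n X \<longleftrightarrow> adjoin constants (X ` {1..n}) = polyring n"

definition triangular :: "nat \<Rightarrow> ('r::comm_ring_1 mpoly \<Rightarrow> 'r mpoly) \<Rightarrow> bool" where
  "triangular n D \<longleftrightarrow>
     (\<exists>X. coordinate_system n X \<and> (\<forall>i\<in>{1..n}. D (X i) \<in> adjoin constants (X ` {1..<i})))"

end

theory Submission
  imports Defs "Jordan_Normal_Form.Determinant"
begin

text \<open>
  Let \<open>A = R[X\<^sub>1, \<dots>, X\<^sub>n]\<close>, let \<open>D\<close> be triangular with respect to \<open>X\<close>, and let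
  \<open>C = R[X\<^sub>1, \<dots>, X\<^sub>n\<^sub>-\<^sub>1]\<close>, which \<open>D\<close> maps to itself. The witness of non-rigidity is a partial
  derivative \<open>\<delta>\<^sub>i = \<partial>/\<partial>X\<^sub>i\<close>: a locally nilpotent derivation of \<open>A\<close> that commutes with \<open>D\<close>
  restricts to the kernel of \<open>D\<close> (\<open>kernel_not_rigid\<close>), and it remains to find an element of the
  kernel that it does not kill.

  Since \<open>D X\<^sub>i\<close> does not involve \<open>X\<^sub>n\<close>, the commutator of \<open>D\<close> and \<open>\<delta>\<^sub>n\<close> kills all generators, so
  \<open>D\<close> and \<open>\<delta>\<^sub>n\<close> commute.

  \<^item> If \<open>D\<close> is non-zero on \<open>C\<close>, it has a local slice in \<open>C\<close>, and
    \<open>local_slice_antiderivative\<close> solves \<open>D c = u * D X\<^sub>n\<close> with \<open>c\<close> and \<open>u \<noteq> 0\<close> in \<open>C\<close> and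
    \<open>D u = 0\<close>. Then \<open>u * X\<^sub>n - c\<close> is in the kernel of \<open>D\<close> and \<open>\<delta>\<^sub>n\<close> maps it to \<open>u\<close>.
  \<^item> If \<open>D X\<^sub>n = 0\<close>, then \<open>X\<^sub>n\<close> is in the kernel of \<open>D\<close> and \<open>\<delta>\<^sub>n X\<^sub>n = 1\<close>.
  \<^item> Otherwise \<open>D = f * \<delta>\<^sub>n\<close> with \<open>f \<noteq> 0\<close>, so \<open>D\<close> and \<open>\<delta>\<^sub>n\<close> have the same kernel. It contains
    \<open>X\<^sub>1\<close> because \<open>n \<ge> 2\<close>, and \<open>\<delta>\<^sub>1\<close> commutes with \<open>\<delta>\<^sub>n\<close>.

  The derivations \<open>\<delta>\<^sub>i\<close> exist for every system of \<open>n\<close> generators, by inverting its Jacobian matrix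
  (\<open>dual_derivations_exist\<close>).
\<close>

section \<open>Subrings and adjunction\<close>

lemma subring_zero: "is_subring A \<Longrightarrow> 0 \<in> A"
  unfolding is_subring_def by (metis diff_self)

lemma subring_one: "is_subring A \<Longrightarrow> 1 \<in> A"
  unfolding is_subring_def by blast

lemma subring_diff: "is_subring A \<Longrightarrow> a \<in> A \<Longrightarrow> b \<in> A \<Longrightarrow> a - b \<in> A"
  unfolding is_subring_def by blast

lemma subring_mult: "is_subring A \<Longrightarrow> a \<in> A \<Longrightarrow> b \<in> A \<Longrightarrow> a * b \<in> A"
  unfolding is_subring_def by blast

lemma subring_add: "is_subring A \<Longrightarrow> a \<in> A \<Longrightarrow> b \<in> A \<Longrightarrow> a + b \<in> A"
  using subring_diff[of A a "0 - b"] subring_diff[of A 0 b] subring_zero[of A] by simp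

lemma subring_of_nat: "is_subring A \<Longrightarrow> of_nat k \<in> A"
  by (induction k) (auto intro: subring_add subring_one subring_zero)

lemma subring_power: "is_subring A \<Longrightarrow> a \<in> A \<Longrightarrow> a ^ k \<in> A"
  by (induction k) (auto intro: subring_mult subring_one)

lemma subring_sum: "is_subring A \<Longrightarrow> (\<And>i. i \<in> I \<Longrightarrow> f i \<in> A) \<Longrightarrow> sum f I \<in> A"
  by (induction I rule: infinite_finite_induct) (auto intro: subring_add subring_zero)

lemmas subring_closed =
  subring_zero subring_one subring_add subring_diff subring_mult subring_of_nat subring_power

lemma is_subring_adjoin: "is_subring (adjoin R S)"
  unfolding adjoin_def
  by (rule hull_in) (auto simp: is_subring_def)

lemma adjoin_base: "r \<in> R \<Longrightarrow> r \<in> adjoin R S"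
  and adjoin_generator: "s \<in> S \<Longrightarrow> s \<in> adjoin R S"
  unfolding adjoin_def by (auto intro: hull_inc)

lemma adjoin_mono: "S \<subseteq> T \<Longrightarrow> adjoin R S \<subseteq> adjoin R T"
  unfolding adjoin_def by (intro hull_mono) auto

lemma adjoin_induct [consumes 2, case_names base generator diff mult]:
  assumes "p \<in> adjoin R S" and "1 \<in> R"
    and "\<And>r. r \<in> R \<Longrightarrow> P r" and "\<And>s. s \<in> S \<Longrightarrow> P s"
    and "\<And>p q. p \<in> adjoin R S \<Longrightarrow> q \<in> adjoin R S \<Longrightarrow> P p \<Longrightarrow> P q \<Longrightarrow> P (p - q)"
    and "\<And>p q. p \<in> adjoin R S \<Longrightarrow> q \<in> adjoin R S \<Longrightarrow> P p \<Longrightarrow> P q \<Longrightarrow> P (p * q)"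
  shows "P p"
proof -
  let ?T = "{x \<in> adjoin R S. P x}"
  have "is_subring ?T"
    using is_subring_adjoin[of R S] assms(2,3,5,6) unfolding is_subring_def by blast
  moreover have "R \<union> S \<subseteq> ?T"
    using assms(3,4) adjoin_base adjoin_generator by blast
  ultimately have "adjoin R S \<subseteq> ?T"
    unfolding adjoin_def[of R S] by (intro hull_minimal)
  then show ?thesis using assms(1) by blast
qed


section \<open>Derivations of a subring\<close>

lemma derivation_closed: "derivation_on A d \<Longrightarrow> a \<in> A \<Longrightarrow> d a \<in> A"
  and derivation_add:
    "derivation_on A d \<Longrightarrow> a \<in> A \<Longrightarrow> b \<in> A \<Longrightarrow> d (a + b) = d a + d b"
  and derivation_mult:
    "derivation_on A d \<Longrightarrow> a \<in> A \<Longrightarrow> b \<in> A \<Longrightarrow> d (a * b) = a * d b + d a * b"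
  unfolding derivation_on_def by blast+

lemma derivation_zero:
  assumes "is_subring A" "derivation_on A d"
  shows "d 0 = 0"
  using derivation_add[OF assms(2), of 0 0] subring_zero[OF assms(1)] by simp

lemma derivation_one:
  assumes "is_subring A" "derivation_on A d"
  shows "d 1 = 0"
  using derivation_mult[OF assms(2), of 1 1] subring_one[OF assms(1)] by simp

lemma derivation_diff:
  assumes "is_subring A" "derivation_on A d" "a \<in> A" "b \<in> A"
  shows "d (a - b) = d a - d b"
  using derivation_add[OF assms(2), of "a - b" b] subring_diff[OF assms(1,3,4)] assms(4) by simp

lemma derivation_of_nat:
  assumes "is_subring A" "derivation_on A d"
  shows "d (of_nat k) = 0"
  by (induction k)
    (simp_all add: derivation_zero[OF assms] derivation_one[OF assms] derivation_add[OF assms(2)]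
      subring_closed[OF assms(1)])

lemma derivation_power_Suc:
  assumes "is_subring A" "derivation_on A d" "r \<in> A"
  shows "d (r ^ Suc k) = of_nat (Suc k) * r ^ k * d r"
proof (induction k)
  case (Suc k)
  have "d (r * r ^ Suc k) = r * d (r ^ Suc k) + d r * r ^ Suc k"
    by (rule derivation_mult) (use assms in \<open>auto intro: subring_power simp del: power_Suc\<close>)
  then show ?case
    unfolding Suc by (simp add: algebra_simps)
qed (simp add: assms)

lemma derivation_funpow_closed:
  assumes "derivation_on A d" "a \<in> A"
  shows "(d ^^ k) a \<in> A"
  by (induction k) (auto intro: derivation_closed assms)

lemma derivation_funpow_zero:
  assumes "is_subring A" "derivation_on A d"
  shows "(d ^^ k) 0 = 0"
  by (induction k) (simp_all add: derivation_zero[OF assms])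

lemma derivation_funpow_add:
  assumes "derivation_on A d" "a \<in> A" "b \<in> A"
  shows "(d ^^ k) (a + b) = (d ^^ k) a + (d ^^ k) b"
  by (induction k)
    (simp_all add: derivation_add[OF assms(1)] derivation_funpow_closed[OF assms(1)] assms(2,3))

lemma derivation_funpow_diff:
  assumes "is_subring A" "derivation_on A d" "a \<in> A" "b \<in> A"
  shows "(d ^^ k) (a - b) = (d ^^ k) a - (d ^^ k) b"
  using derivation_funpow_add[OF assms(2), of "a - b" b] subring_diff[OF assms(1,3,4)] assms(4)
  by simp

lemma funpow_eq_zero_mono:
  assumes "is_subring A" "derivation_on A d" "(d ^^ i) a = 0" "i \<le> k"
  shows "(d ^^ k) a = 0"
proof -
  have "(d ^^ k) a = (d ^^ (k - i)) ((d ^^ i) a)"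
    using assms(4) by (metis comp_apply funpow_add le_add_diff_inverse2)
  then show ?thesis
    by (simp add: assms(3) derivation_funpow_zero[OF assms(1,2)])
qed

lemma derivations_agree:
  assumes "1 \<in> R" "derivation_on (adjoin R S) d" "derivation_on (adjoin R S) e"
    and "\<And>r. r \<in> R \<Longrightarrow> d r = e r" "\<And>s. s \<in> S \<Longrightarrow> d s = e s" "p \<in> adjoin R S"
  shows "d p = e p"
  using assms(6,1)
proof (induction rule: adjoin_induct)
  case (diff p q)
  then show ?case
    using derivation_diff[OF is_subring_adjoin assms(2)]
      derivation_diff[OF is_subring_adjoin assms(3)] by simp
next
  case (mult p q)
  then show ?case
    using derivation_mult[OF assms(2)] derivation_mult[OF assms(3)] by simp
qed (auto simp: assms)

lemma derivation_commutator:
  assumes "is_subring A" "derivation_on A d" "derivation_on A e"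
  shows "derivation_on A (\<lambda>a. d (e a) - e (d a))"
proof -
  have c: "d a \<in> A" "e a \<in> A" if "a \<in> A" for a
    using that assms derivation_closed by blast+
  show ?thesis
    unfolding derivation_on_def
  proof (intro conjI ballI)
    fix a b assume ab: "a \<in> A" "b \<in> A"
    note cab = c[OF ab(1)] c[OF ab(2)]
    show "d (e a) - e (d a) \<in> A"
      by (intro subring_diff[OF assms(1)] c cab)
    show "d (e (a + b)) - e (d (a + b)) = d (e a) - e (d a) + (d (e b) - e (d b))"
      using ab cab by (simp add: derivation_add[OF assms(2)] derivation_add[OF assms(3)])
    have "d (e (a * b)) = d (a * e b) + d (e a * b)" "e (d (a * b)) = e (a * d b) + e (d a * b)"
      using ab cab
      by (simp_all add: derivation_mult[OF assms(2)] derivation_mult[OF assms(3)]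
          derivation_add[OF assms(2)] derivation_add[OF assms(3)] subring_mult[OF assms(1)])
    then show "d (e (a * b)) - e (d (a * b)) =
        a * (d (e b) - e (d b)) + (d (e a) - e (d a)) * b"
      using ab cab
      by (simp add: derivation_mult[OF assms(2)] derivation_mult[OF assms(3)] algebra_simps)
  qed
qed

lemma derivation_null: "is_subring A \<Longrightarrow> derivation_on A (\<lambda>_. 0)"
  unfolding derivation_on_def by (simp add: subring_zero)

lemma derivation_scale:
  assumes "is_subring A" "derivation_on A d" "f \<in> A"
  shows "derivation_on A (\<lambda>a. f * d a)"
  unfolding derivation_on_def
proof (intro conjI ballI)
  fix a b assume ab: "a \<in> A" "b \<in> A"
  show "f * d a \<in> A"
    by (intro subring_mult[OF assms(1,3)] derivation_closed[OF assms(2)] ab)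
  show "f * d (a + b) = f * d a + f * d b"
    by (simp add: derivation_add[OF assms(2) ab] distrib_left)
  show "f * d (a * b) = a * (f * d b) + f * d a * b"
    by (simp add: derivation_mult[OF assms(2) ab] algebra_simps)
qed

lemma derivation_sum:
  assumes "is_subring A" "\<And>i. i \<in> I \<Longrightarrow> derivation_on A (d i)"
  shows "derivation_on A (\<lambda>a. \<Sum>i\<in>I. d i a)"
  unfolding derivation_on_def
proof (intro conjI ballI)
  fix a b assume ab: "a \<in> A" "b \<in> A"
  show "(\<Sum>i\<in>I. d i a) \<in> A"
    by (intro subring_sum[OF assms(1)] derivation_closed[OF assms(2)] ab)
  have "(\<Sum>i\<in>I. d i (a + b)) = (\<Sum>i\<in>I. d i a + d i b)"
    using ab by (intro sum.cong refl derivation_add[OF assms(2)])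
  then show "(\<Sum>i\<in>I. d i (a + b)) = (\<Sum>i\<in>I. d i a) + (\<Sum>i\<in>I. d i b)"
    by (simp add: sum.distrib)
  have "(\<Sum>i\<in>I. d i (a * b)) = (\<Sum>i\<in>I. a * d i b + d i a * b)"
    using ab by (intro sum.cong refl derivation_mult[OF assms(2)])
  then show "(\<Sum>i\<in>I. d i (a * b)) = a * (\<Sum>i\<in>I. d i b) + (\<Sum>i\<in>I. d i a) * b"
    by (simp add: sum.distrib sum_distrib_left sum_distrib_right)
qed

lemma derivations_commute:
  assumes "1 \<in> R" "derivation_on (adjoin R S) d" "derivation_on (adjoin R S) e"
    and "\<And>r. r \<in> R \<Longrightarrow> d r = 0" "\<And>r. r \<in> R \<Longrightarrow> e r = 0"
    and "\<And>s. s \<in> S \<Longrightarrow> d (e s) = e (d s)" "p \<in> adjoin R S"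
  shows "d (e p) = e (d p)"
proof -
  have "d (e p) - e (d p) = 0"
    by (rule derivations_agree[OF assms(1) derivation_commutator[OF is_subring_adjoin assms(2,3)]
          derivation_null[OF is_subring_adjoin] _ _ assms(7)])
      (simp_all add: assms(4-6) derivation_zero[OF is_subring_adjoin assms(2)]
          derivation_zero[OF is_subring_adjoin assms(3)])
  then show ?thesis by simp
qed


section \<open>Local nilpotence\<close>

text \<open>By the Leibniz rule, each application of \<open>d\<close> to a product uses up one application on one
  of the two factors. Hence the elements killed by some power of \<open>d\<close> form a subring.\<close>

lemma nilpotent_mult:
  assumes "is_subring A" "derivation_on A d"
  shows "a \<in> A \<Longrightarrow> b \<in> A \<Longrightarrow> (d ^^ i) a = 0 \<Longrightarrow> (d ^^ j) b = 0 \<Longrightarrow> i + j \<le> Suc k \<Longrightarrow>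
    (d ^^ k) (a * b) = 0"
proof (induction k arbitrary: a b i j)
  case 0
  then have "i = 0 \<or> j = 0" by auto
  then show ?case using 0 by auto
next
  case (Suc k)
  show ?case
  proof (cases "i = 0 \<or> j = 0")
    case True
    then show ?thesis
      using Suc.prems derivation_funpow_zero[OF assms, of "Suc k"] by auto
  next
    case False
    then obtain i' j' where ij: "i = Suc i'" "j = Suc j'"
      by (meson not0_implies_Suc)
    have da: "d a \<in> A" "d b \<in> A"
      using Suc.prems derivation_closed[OF assms(2)] by auto
    have "(d ^^ k) (a * d b) = 0"
      by (rule Suc.IH[of _ _ i j']) (use Suc.prems da ij in \<open>auto simp: funpow_swap1\<close>)
    moreover have "(d ^^ k) (d a * b) = 0"
      by (rule Suc.IH[of _ _ i' j]) (use Suc.prems da ij in \<open>auto simp: funpow_swap1\<close>)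
    moreover have "(d ^^ Suc k) (a * b) = (d ^^ k) (a * d b + d a * b)"
      using Suc.prems by (simp add: funpow_swap1 derivation_mult[OF assms(2)])
    ultimately show ?thesis
      using Suc.prems da assms(1)
      by (simp add: derivation_funpow_add[OF assms(2)] subring_mult)
  qed
qed

lemma LND_adjoin:
  assumes "1 \<in> R" "derivation_on (adjoin R S) d" "\<And>r. r \<in> R \<Longrightarrow> d r = 0"
    and "\<And>s. s \<in> S \<Longrightarrow> \<exists>m. (d ^^ m) s = 0"
  shows "d \<in> LND (adjoin R S)"
proof -
  note A = is_subring_adjoin[of R S]
  have "\<exists>m. (d ^^ m) p = 0" if "p \<in> adjoin R S" for p
    using that assms(1)
  proof (induction rule: adjoin_induct)
    case (base r)
    then have "(d ^^ 1) r = 0" using assms(3) by simp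
    then show ?case by blast
  next
    case (diff p q)
    then obtain i j where "(d ^^ i) p = 0" "(d ^^ j) q = 0" by blast
    then have "(d ^^ (i + j)) p = 0" "(d ^^ (i + j)) q = 0"
      using funpow_eq_zero_mono[OF A assms(2)] by auto
    then have "(d ^^ (i + j)) (p - q) = 0"
      using diff by (simp add: derivation_funpow_diff[OF A assms(2)])
    then show ?case by blast
  next
    case (mult p q)
    then obtain i j where "(d ^^ i) p = 0" "(d ^^ j) q = 0" by blast
    then have "(d ^^ (i + j)) (p * q) = 0"
      using nilpotent_mult[OF A assms(2) mult(1,2)] by auto
    then show ?case by blast
  qed (use assms(4) in blast)
  then have "\<exists>m>0. (d ^^ m) p = 0" if "p \<in> adjoin R S" for p
    using that funpow_eq_zero_mono[OF A assms(2) _ le_SucI[OF order_refl]] zero_less_Suc by blast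
  then show ?thesis
    unfolding LND_def using assms(2) by auto
qed

text \<open>A locally nilpotent derivation that commutes with \<open>D\<close> maps the kernel of \<open>D\<close> to itself.\<close>

lemma kernel_not_rigid:
  assumes "is_subring A" "derivation_on A D" "e \<in> LND A"
    and "\<And>a. a \<in> A \<Longrightarrow> D (e a) = e (D a)"
    and "a \<in> A" "D a = 0" "e a \<noteq> 0"
  shows "\<not> rigid (ker_on A D)"
proof -
  have e: "derivation_on A e" using assms(3) by (simp add: LND_def)
  have "e \<in> LND (ker_on A D)"
    using assms(3,4) derivation_zero[OF assms(1) e]
    unfolding LND_def derivation_on_def ker_on_def by auto
  then show ?thesis
    using assms(5-7) unfolding rigid_def ker_on_def by blast
qed

text \<open>Such an \<open>r\<close> is called a local slice; among the iterates \<open>c, D c, \<dots>\<close> it is the one two steps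
  before they vanish.\<close>

lemma local_slice_exists:
  assumes "is_subring C" "derivation_on C D" "c \<in> C" "D c \<noteq> 0" "(D ^^ m) c = 0"
  shows "\<exists>r\<in>C. D r \<noteq> 0 \<and> D (D r) = 0"
  using assms(3-5)
proof (induction m arbitrary: c)
  case 0
  then show ?case using derivation_zero[OF assms(1,2)] by simp
next
  case (Suc m)
  show ?case
  proof (cases "D (D c) = 0")
    case False
    then show ?thesis
      using Suc.IH[of "D c"] Suc.prems derivation_closed[OF assms(2)] by (simp add: funpow_swap1)
  qed (use Suc in auto)
qed

text \<open>After inverting \<open>s = D r\<close> for a local slice \<open>r\<close>, a locally nilpotent derivation is
  surjective: \<open>D (f * r ^ Suc j)\<close> equals \<open>of_nat (Suc j) * s * f * r ^ j\<close> up to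
  \<open>D f * r ^ Suc j\<close>, and \<open>D f\<close> is closer to \<open>0\<close> than \<open>f\<close>. Carrying the powers of \<open>r\<close> along makes
  this an induction; \<open>u\<close> collects the denominators, which include the integers \<open>Suc j\<close> and are
  non-zero because the characteristic is zero.\<close>

lemma local_slice_antiderivative:
  fixes D :: "'a::idom \<Rightarrow> 'a"
  assumes C: "is_subring C" and D: "derivation_on C D" and char: "CHAR('a) = 0"
    and r: "r \<in> C" "D r \<noteq> 0" "D (D r) = 0"
  shows "f \<in> C \<Longrightarrow> (D ^^ m) f = 0 \<Longrightarrow>
    \<exists>c\<in>C. \<exists>u\<in>C. u \<noteq> 0 \<and> D u = 0 \<and> D c = u * f * r ^ j"
proof (induction m arbitrary: f j)
  case 0
  then show ?case
    using subring_zero[OF C] subring_one[OF C] derivation_zero[OF C D] derivation_one[OF C D]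
    by (intro bexI[of _ 0] bexI[of _ 1]) auto
next
  case (Suc m)
  define s where "s = D r"
  have s: "s \<in> C" "D s = 0" "s \<noteq> 0"
    using r derivation_closed[OF D] by (auto simp: s_def)
  have Df: "D f \<in> C" using Suc.prems derivation_closed[OF D] by auto
  obtain c u where cu: "c \<in> C" "u \<in> C" "u \<noteq> 0" "D u = 0" "D c = u * D f * r ^ Suc j"
    using Suc.IH[OF Df, of "Suc j"] Suc.prems(2) by (auto simp: funpow_swap1)
  define c' where "c' = u * (f * r ^ Suc j) - c"
  define u' where "u' = of_nat (Suc j) * (u * s)"
  have rC: "r ^ Suc j \<in> C" using C r(1) by (rule subring_power)
  have frC: "f * r ^ Suc j \<in> C" "u * (f * r ^ Suc j) \<in> C"
    using C Suc.prems(1) rC cu(2) by (simp_all add: subring_mult del: power_Suc)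
  have "D c' = u * D (f * r ^ Suc j) - D c"
    unfolding c'_def using frC cu
    by (simp add: derivation_diff[OF C D] derivation_mult[OF D] del: power_Suc)
  also have "\<dots> = u * (f * (of_nat (Suc j) * r ^ j * s) + D f * r ^ Suc j) - u * D f * r ^ Suc j"
    using derivation_mult[OF D Suc.prems(1) rC] derivation_power_Suc[OF C D r(1), of j] cu(5)
    by (simp add: s_def del: power_Suc of_nat_Suc)
  also have "\<dots> = u' * f * r ^ j"
    by (simp add: u'_def algebra_simps)
  finally have "D c' = u' * f * r ^ j" .
  moreover have "c' \<in> C" "u' \<in> C"
    unfolding c'_def u'_def using C frC cu s by (simp_all add: subring_closed del: power_Suc)
  moreover have "u' \<noteq> 0"
    using char cu(3) s(3) unfolding u'_def CHAR_eq0_iff by auto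
  moreover have "D u' = 0"
    unfolding u'_def using C cu s
    by (simp add: derivation_mult[OF D] derivation_of_nat[OF C D] subring_closed del: of_nat_Suc)
  ultimately show ?case by blast
qed


section \<open>Partial derivatives on the polynomial ring\<close>

text \<open>The coefficient of the monomial \<open>m\<close> in \<open>\<partial>p/\<partial>x\<^sub>j\<close> comes from that of \<open>m * x\<^sub>j\<close> in \<open>p\<close>; the exponent
  vectors are written additively. In this form additivity is immediate, and the product rule reduces to
  monomials.\<close>

lift_definition partial :: "nat \<Rightarrow> 'r::comm_ring_1 mpoly \<Rightarrow> 'r mpoly" is
  "\<lambda>j p m. of_nat (Suc (Poly_Mapping.lookup m j)) * p (m + Poly_Mapping.single j 1)"
proof -
  fix j :: nat and p :: "(nat \<Rightarrow>\<^sub>0 nat) \<Rightarrow> 'r"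
  assume "finite {m. p m \<noteq> 0}"
  then have "finite ((\<lambda>m. m + Poly_Mapping.single j 1) -` {m. p m \<noteq> 0})"
    by (rule finite_vimageI) (simp add: inj_on_def)
  then show
    "finite {m. of_nat (Suc (Poly_Mapping.lookup m j)) * p (m + Poly_Mapping.single j 1) \<noteq> 0}"
    by (rule rev_finite_subset) auto
qed

lemma partial_add: "partial j (p + q) = partial j p + partial j q"
  by transfer (simp add: fun_eq_iff algebra_simps)

lemma partial_single:
  "partial j (Poly_Mapping.single m c) =
     Poly_Mapping.single (m - Poly_Mapping.single j 1) (of_nat (Poly_Mapping.lookup m j) * c)"
proof (rule poly_mapping_eqI)
  fix k
  let ?e = "Poly_Mapping.single j (1::nat)"
  show "Poly_Mapping.lookup (partial j (Poly_Mapping.single m c)) k =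
      Poly_Mapping.lookup
        (Poly_Mapping.single (m - ?e) (of_nat (Poly_Mapping.lookup m j) * c)) k"
  proof (cases "m = k + ?e")
    case True
    then show ?thesis by (simp add: partial.rep_eq lookup_add)
  next
    case False
    have "m = k + ?e" if "Poly_Mapping.lookup m j \<noteq> 0" "m - ?e = k"
      using that
      by (intro poly_mapping_eqI) (auto simp: lookup_add lookup_minus lookup_single when_def)
    with False have "Poly_Mapping.lookup m j = 0 \<or> m - ?e \<noteq> k" by blast
    then show ?thesis
      using False by (auto simp: partial.rep_eq lookup_single)
  qed
qed

lemma partial_mult_single:
  "partial j (Poly_Mapping.single m c * Poly_Mapping.single m' c') =
     Poly_Mapping.single m c * partial j (Poly_Mapping.single m' c') +
     partial j (Poly_Mapping.single m c) * Poly_Mapping.single m' c'"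
proof -
  let ?e = "Poly_Mapping.single j (1::nat)"
  \<comment> \<open>Subtraction of exponents is truncated, so the two monomials can differ if \<open>x\<^sub>j\<close> does not occur
    in \<open>k'\<close>; then the coefficient vanishes.\<close>
  have shift: "Poly_Mapping.single (k + (k' - ?e)) (of_nat (Poly_Mapping.lookup k' j) * b) =
      Poly_Mapping.single (k + k' - ?e) (of_nat (Poly_Mapping.lookup k' j) * b)" for k k' and b :: 'a
  proof (cases "Poly_Mapping.lookup k' j = 0")
    case False
    then have "k + (k' - ?e) = k + k' - ?e"
      by (intro poly_mapping_eqI) (auto simp: lookup_add lookup_minus lookup_single when_def)
    then show ?thesis by simp
  qed simp
  show ?thesis
    using shift[of m m' "c * c'"] shift[of m' m "c * c'"]
    by (simp add: partial_single mult_single lookup_add single_add algebra_simps)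
qed

lemma mpoly_induct [case_names zero add_single]:
  fixes p :: "'r::comm_ring_1 mpoly"
  assumes "P 0" and "\<And>q m c. P q \<Longrightarrow> P (q + Poly_Mapping.single m c)"
  shows "P p"
proof (induction p rule: update_induct)
  case (update f a b)
  then have "Poly_Mapping.update a b f = f + Poly_Mapping.single a b"
    by (intro poly_mapping_eqI)
      (auto simp: lookup_update lookup_add lookup_single when_def in_keys_iff)
  then show ?case using assms(2) update by simp
qed (rule assms(1))

lemma partial_zero: "partial j 0 = 0"
  by transfer simp

lemma partial_mult: "partial j (p * q) = p * partial j q + partial j p * q"
proof (induction p rule: mpoly_induct)
  case zero
  then show ?case by (simp add: partial_zero)
next
  case (add_single p m c)
  have "partial j (Poly_Mapping.single m c * q) =
    Poly_Mapping.single m c * partial j q + partial j (Poly_Mapping.single m c) * q"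
    by (induction q rule: mpoly_induct)
      (simp_all add: partial_zero partial_add partial_mult_single algebra_simps)
  then show ?case
    using add_single by (simp add: partial_add algebra_simps)
qed

lemma partial_constant: "c \<in> constants \<Longrightarrow> partial j c = 0"
  by (auto simp: constants_def partial_single)

lemma partial_variable:
  "partial j (Poly_Mapping.single (Poly_Mapping.single k 1) 1) = (if k = j then 1 else 0)"
  by (auto simp: partial_single lookup_single single_one)

lemma partial_derivation: "derivation_on (polyring n) (partial j)"
proof -
  have "partial j p \<in> polyring n" if "p \<in> polyring n" for p :: "'a mpoly"
  proof -
    have "Poly_Mapping.keys m \<subseteq> {1..n}" if "m \<in> Poly_Mapping.keys (partial j p)" for m
    proof -
      have "Poly_Mapping.lookup p (m + Poly_Mapping.single j 1) \<noteq> 0"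
        using that by (auto simp: in_keys_iff partial.rep_eq)
      then have "Poly_Mapping.keys (m + Poly_Mapping.single j 1) \<subseteq> {1..n}"
        using \<open>p \<in> polyring n\<close> by (auto simp: polyring_def in_keys_iff)
      moreover have "Poly_Mapping.keys m \<subseteq> Poly_Mapping.keys (m + Poly_Mapping.single j 1)"
        by (auto simp: in_keys_iff lookup_add)
      ultimately show ?thesis by blast
    qed
    then show ?thesis by (simp add: polyring_def)
  qed
  then show ?thesis
    unfolding derivation_on_def by (simp add: partial_add partial_mult)
qed

lemma variable_in_polyring:
  "j \<in> {1..n} \<Longrightarrow> Poly_Mapping.single (Poly_Mapping.single j 1) 1 \<in> polyring n"
  by (auto simp: polyring_def split: if_splits)

lemma one_in_constants: "1 \<in> constants"
  unfolding constants_def by (metis rangeI single_one)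


section \<open>Derivations dual to a coordinate system\<close>

text \<open>If \<open>p\<close> is written as a polynomial in the \<open>X l\<close>, then \<open>g l\<close> is the formal partial derivative
  of that polynomial, evaluated at \<open>X\<close>. The point is that \<open>g\<close> does not depend on \<open>d\<close>.\<close>

lemma chain_rule:
  fixes p :: "'a::comm_ring_1"
  assumes "1 \<in> R" "finite I" "p \<in> adjoin R (X ` I)"
  shows "\<exists>g. (\<forall>l\<in>I. g l \<in> adjoin R (X ` I)) \<and>
    (\<forall>d. derivation_on (adjoin R (X ` I)) d \<and> (\<forall>r\<in>R. d r = 0) \<longrightarrow>
      d p = (\<Sum>l\<in>I. g l * d (X l)))"
proof -
  let ?A = "adjoin R (X ` I)"
  define expands where "expands p g \<longleftrightarrow> (\<forall>l\<in>I. g l \<in> ?A) \<and>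
    (\<forall>d. derivation_on ?A d \<and> (\<forall>r\<in>R. d r = 0) \<longrightarrow> d p = (\<Sum>l\<in>I. g l * d (X l)))" for p g
  note A = is_subring_adjoin[of R "X ` I"]
  have expandsI: "expands p g"
    if "\<And>l. l \<in> I \<Longrightarrow> g l \<in> ?A" "\<And>d. derivation_on ?A d \<Longrightarrow> \<forall>r\<in>R. d r = 0 \<Longrightarrow>
      d p = (\<Sum>l\<in>I. g l * d (X l))" for p g
    using that unfolding expands_def by blast
  have expands_closed: "g l \<in> ?A" if "expands p g" "l \<in> I" for p g l
    using that unfolding expands_def by blast
  have expands_eq: "d p = (\<Sum>l\<in>I. g l * d (X l))"
    if "expands p g" "derivation_on ?A d" "\<forall>r\<in>R. d r = 0" for p g d
    using that unfolding expands_def by blast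
  have "\<exists>g. expands p g"
    using assms(3,1)
  proof (induction rule: adjoin_induct)
    case (base r)
    have "expands r (\<lambda>_. 0)"
      by (rule expandsI) (simp_all add: base subring_zero[OF A])
    then show ?case by blast
  next
    case (generator s)
    then obtain k where k: "k \<in> I" "s = X k" by auto
    have "expands s (\<lambda>l. if l = k then 1 else 0)"
    proof (rule expandsI)
      show "(if l = k then 1 else 0) \<in> ?A" for l
        by (simp add: subring_zero[OF A] subring_one[OF A])
      fix d :: "'a \<Rightarrow> 'a"
      have "(\<Sum>l\<in>I. (if l = k then 1 else 0) * d (X l)) = (\<Sum>l\<in>I. if l = k then d (X l) else 0)"
        by (rule sum.cong) auto
      then show "d s = (\<Sum>l\<in>I. (if l = k then 1 else 0) * d (X l))"
        using k assms(2) by simp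
    qed
    then show ?case by blast
  next
    case (diff p q)
    then obtain g h where gh: "expands p g" "expands q h" by blast
    have "expands (p - q) (\<lambda>l. g l - h l)"
    proof (rule expandsI)
      show "g l - h l \<in> ?A" if "l \<in> I" for l
        by (intro subring_diff[OF A] expands_closed[OF gh(1) that] expands_closed[OF gh(2) that])
      show "d (p - q) = (\<Sum>l\<in>I. (g l - h l) * d (X l))"
        if "derivation_on ?A d" "\<forall>r\<in>R. d r = 0" for d
        unfolding derivation_diff[OF A that(1) diff(1,2)] expands_eq[OF gh(1) that]
          expands_eq[OF gh(2) that] by (simp add: left_diff_distrib sum_subtractf)
    qed
    then show ?case by blast
  next
    case (mult p q)
    then obtain g h where gh: "expands p g" "expands q h" by blast
    have "expands (p * q) (\<lambda>l. p * h l + g l * q)"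
    proof (rule expandsI)
      show "p * h l + g l * q \<in> ?A" if "l \<in> I" for l
        by (intro subring_add[OF A] subring_mult[OF A] mult(1,2)
            expands_closed[OF gh(1) that] expands_closed[OF gh(2) that])
      show "d (p * q) = (\<Sum>l\<in>I. (p * h l + g l * q) * d (X l))"
        if "derivation_on ?A d" "\<forall>r\<in>R. d r = 0" for d
        unfolding derivation_mult[OF that(1) mult(1,2)] expands_eq[OF gh(1) that]
          expands_eq[OF gh(2) that]
        by (simp add: sum_distrib_left sum_distrib_right sum.distrib algebra_simps)
    qed
    then show ?case by blast
  qed
  then show ?thesis unfolding expands_def .
qed

text \<open>Over a field this is a dimension count; over a commutative ring the adjugate supplies a left
  inverse of \<open>M\<close>, because \<open>det M\<close> is a unit with inverse \<open>det N\<close>.\<close>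

lemma mat_right_inverse_imp_left:
  fixes M N :: "'a::comm_ring_1 mat"
  assumes M: "M \<in> carrier_mat n n" and N: "N \<in> carrier_mat n n" and MN: "M * N = 1\<^sub>m n"
  shows "N * M = 1\<^sub>m n"
proof -
  define L where "L = det N \<cdot>\<^sub>m adj_mat M"
  have L: "L \<in> carrier_mat n n" using adj_mat(1)[OF M] by (simp add: L_def)
  have "det M * det N = 1" using det_mult[OF M N] MN by simp
  then have LM: "L * M = 1\<^sub>m n"
    using mult_smult_assoc_mat[OF adj_mat(1)[OF M] M, of "det N"] adj_mat(3)[OF M]
    by (auto simp: L_def mult.commute mult.assoc[symmetric] intro!: eq_matI)
  \<comment> \<open>A left and a right inverse of \<open>M\<close> coincide.\<close>
  have "N = L * M * N" using N LM by simp
  also have "\<dots> = L" using L M N MN by (simp add: assoc_mult_mat[of L n n M n N n])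
  finally show ?thesis using LM by simp
qed

lemma sum_product_right_inverse_imp_left:
  fixes f g :: "nat \<Rightarrow> nat \<Rightarrow> 'a::comm_ring_1"
  assumes "\<And>i k. i \<in> {1..n} \<Longrightarrow> k \<in> {1..n} \<Longrightarrow>
      (\<Sum>l=1..n. f i l * g l k) = (if i = k then 1 else 0)"
    and "i \<in> {1..n}" "k \<in> {1..n}"
  shows "(\<Sum>l=1..n. g i l * f l k) = (if i = k then 1 else 0)"
proof -
  define M where "M = mat n n (\<lambda>(i, j). f (Suc i) (Suc j))"
  define N where "N = mat n n (\<lambda>(i, j). g (Suc i) (Suc j))"
  have shift: "(\<Sum>l=1..n. h l) = (\<Sum>l=0..<n. h (Suc l))" for h :: "nat \<Rightarrow> 'a"
    by (simp add: sum.shift_bounds_Suc_ivl[symmetric] atLeastLessThanSuc_atLeastAtMost)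
  have "M * N = 1\<^sub>m n"
    using assms(1) unfolding shift
    by (intro eq_matI) (auto simp: M_def N_def scalar_prod_def)
  then have "N * M = 1\<^sub>m n"
    by (rule mat_right_inverse_imp_left[rotated 2]) (simp_all add: M_def N_def)
  then have "(N * M) $$ (i - 1, k - 1) = 1\<^sub>m n $$ (i - 1, k - 1)" by simp
  moreover have "i - 1 < n" "k - 1 < n" "Suc (i - 1) = i" "Suc (k - 1) = k"
    using assms(2,3) by auto
  ultimately show ?thesis
    unfolding shift using assms(2,3) by (auto simp: M_def N_def scalar_prod_def)
qed

text \<open>With \<open>x j\<close> the standard variables, the chain rule gives \<open>g j\<close> with
  \<open>\<Sum>l. g j l * partial k (X l) = partial k (x j)\<close>, so the matrix \<open>g\<close> is a left inverse of the
  Jacobian matrix of \<open>X\<close>. Over a commutative ring it is a two-sided inverse, and the other product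
  says that \<open>\<Sum>j. g j i * partial j\<close> is the partial derivative with respect to \<open>X i\<close>. Formal
  differentiation of polynomial expressions in the \<open>X i\<close> would not do as a definition: the \<open>X i\<close>
  are given as generators, so two expressions for one element have to be compared.\<close>

lemma dual_derivations_exist:
  fixes X :: "nat \<Rightarrow> 'r::comm_ring_1 mpoly"
  assumes "coordinate_system n X"
  shows "\<exists>\<delta>. \<forall>i\<in>{1..n}. derivation_on (polyring n) (\<delta> i) \<and> (\<forall>c\<in>constants. \<delta> i c = 0) \<and>
    (\<forall>l\<in>{1..n}. \<delta> i (X l) = (if l = i then 1 else 0))"
proof -
  have A: "adjoin constants (X ` {1..n}) = polyring n"
    using assms by (simp add: coordinate_system_def)
  have sub: "is_subring (polyring n :: 'r mpoly set)"
    using is_subring_adjoin A by metis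
  let ?x = "\<lambda>j. Poly_Mapping.single (Poly_Mapping.single j 1) 1 :: 'r mpoly"
  have "\<exists>g. \<forall>j\<in>{1..n}. (\<forall>l\<in>{1..n}. g j l \<in> polyring n) \<and>
    (\<forall>d. derivation_on (polyring n) d \<and> (\<forall>r\<in>constants. d r = 0) \<longrightarrow>
      d (?x j) = (\<Sum>l=1..n. g j l * d (X l)))"
  proof (rule bchoice, rule ballI)
    fix j assume "j \<in> {1..n}"
    then have "?x j \<in> adjoin constants (X ` {1..n})"
      unfolding A by (rule variable_in_polyring)
    from chain_rule[OF one_in_constants finite_atLeastAtMost this, unfolded A]
    show "\<exists>g. (\<forall>l\<in>{1..n}. g l \<in> polyring n) \<and>
      (\<forall>d. derivation_on (polyring n) d \<and> (\<forall>r\<in>constants. d r = 0) \<longrightarrow>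
        d (?x j) = (\<Sum>l=1..n. g l * d (X l)))" .
  qed
  then obtain g where g: "\<And>j l. j \<in> {1..n} \<Longrightarrow> l \<in> {1..n} \<Longrightarrow> g j l \<in> polyring n"
    "\<And>j d. j \<in> {1..n} \<Longrightarrow> derivation_on (polyring n) d \<Longrightarrow> \<forall>r\<in>constants. d r = 0 \<Longrightarrow>
      d (?x j) = (\<Sum>l=1..n. g j l * d (X l))"
    by blast
  have "(\<Sum>l=1..n. g j l * partial k (X l)) = (if j = k then 1 else 0)"
    if "j \<in> {1..n}" for j k
  proof -
    have "partial k (?x j) = (\<Sum>l=1..n. g j l * partial k (X l))"
      by (intro g(2) that partial_derivation ballI partial_constant)
    then show ?thesis by (simp only: partial_variable)
  qed
  then have inv: "(\<Sum>j=1..n. partial j (X l) * g j i) = (if l = i then 1 else 0)"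
    if "l \<in> {1..n}" "i \<in> {1..n}" for l i
    using sum_product_right_inverse_imp_left[of n g "\<lambda>l k. partial k (X l)" l i] that by simp
  define \<delta> where "\<delta> i p = (\<Sum>j=1..n. g j i * partial j p)" for i p
  show ?thesis
  proof (rule exI[of _ \<delta>], intro ballI conjI)
    fix i assume i: "i \<in> {1..n}"
    show "derivation_on (polyring n) (\<delta> i)"
      unfolding \<delta>_def
      by (intro derivation_sum derivation_scale sub partial_derivation g(1) i)
    show "\<delta> i c = 0" if "c \<in> constants" for c
      using that by (simp add: \<delta>_def partial_constant)
    show "\<delta> i (X l) = (if l = i then 1 else 0)" if "l \<in> {1..n}" for l
      using inv[OF that i] by (simp add: \<delta>_def mult.commute)
  qed
qed


section \<open>Kernels of triangular derivations\<close>

theorem theorem4p7: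
  fixes K :: "'r::idom set"
    and n :: nat
    and D :: "'r mpoly \<Rightarrow> 'r mpoly"
  assumes "is_subfield K"
    and "CHAR('r) = 0"
    and "n \<ge> 2"
    and "D \<in> LND_over constants (polyring n)"
    and "triangular n D"
  shows "\<not> rigid (ker_on (polyring n) D)"
proof -
  let ?A = "polyring n :: 'r mpoly set"
  obtain X where X: "coordinate_system n X"
    and tri: "\<And>i. i \<in> {1..n} \<Longrightarrow> D (X i) \<in> adjoin constants (X ` {1..<i})"
    using assms(5) unfolding triangular_def by blast
  have A: "adjoin constants (X ` {1..n}) = ?A"
    using X by (simp add: coordinate_system_def)
  have sub: "is_subring ?A" using is_subring_adjoin A by metis
  have XA: "X i \<in> ?A" if "i \<in> {1..n}" for i
    using that adjoin_generator A by blast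
  have LND: "D \<in> LND ?A" and DR: "\<And>c. c \<in> constants \<Longrightarrow> D c = 0"
    using assms(4) by (auto simp: LND_over_def ker_on_def)
  then have D: "derivation_on ?A D" by (simp add: LND_def)
  obtain \<delta> where "\<forall>i\<in>{1..n}. derivation_on ?A (\<delta> i) \<and> (\<forall>c\<in>constants. \<delta> i c = 0) \<and>
      (\<forall>l\<in>{1..n}. \<delta> i (X l) = (if l = i then 1 else 0))"
    using dual_derivations_exist[OF X] ..
  then have \<delta>: "\<And>i. i \<in> {1..n} \<Longrightarrow> derivation_on ?A (\<delta> i)"
    "\<And>i c. i \<in> {1..n} \<Longrightarrow> c \<in> constants \<Longrightarrow> \<delta> i c = 0"
    "\<And>i l. i \<in> {1..n} \<Longrightarrow> l \<in> {1..n} \<Longrightarrow> \<delta> i (X l) = (if l = i then 1 else 0)"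
    by blast+
  have n: "n \<in> {1..n}" "1 \<in> {1..n}" "1 \<noteq> n" using assms(3) by auto

  have \<delta>_LND: "\<delta> i \<in> LND ?A" if "i \<in> {1..n}" for i
  proof -
    have "(\<delta> i ^^ 2) (X l) = 0" if "l \<in> {1..n}" for l
      using \<delta>[OF \<open>i \<in> {1..n}\<close>] that derivation_zero[OF sub] derivation_one[OF sub]
      by (simp add: numeral_2_eq_2)
    then have "\<exists>m. (\<delta> i ^^ m) s = 0" if "s \<in> X ` {1..n}" for s
      using that by blast
    then show ?thesis
      using LND_adjoin[OF one_in_constants, of "X ` {1..n}" "\<delta> i", unfolded A] \<delta> that by blast
  qed

  define C where "C = adjoin constants (X ` {1..<n})"
  have C: "is_subring C" unfolding C_def by (rule is_subring_adjoin)
  have CA: "C \<subseteq> ?A"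
    unfolding C_def A[symmetric] by (rule adjoin_mono) auto
  have \<delta>C: "\<delta> n p = 0" if "p \<in> C" for p
    using that one_in_constants unfolding C_def
  proof (induction rule: adjoin_induct)
    case (diff p q)
    then show ?case
      using derivation_diff[OF sub \<delta>(1)[OF n(1)], of p q] CA C_def by auto
  next
    case (mult p q)
    then show ?case
      using derivation_mult[OF \<delta>(1)[OF n(1)], of p q] CA C_def by auto
  qed (use \<delta> n in auto)
  have lower: "adjoin constants (X ` {1..<i}) \<subseteq> C" if "i \<le> n" for i
    unfolding C_def using that by (intro adjoin_mono) auto
  have DXC: "D (X i) \<in> C" if "i \<in> {1..n}" for i
    using tri[OF that] lower[of i] that by auto
  have DC: "D p \<in> C" if "p \<in> C" for p
    using that one_in_constants unfolding C_def
  proof (induction rule: adjoin_induct)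
    case (diff p q)
    then have "p \<in> ?A" "q \<in> ?A" using CA C_def by auto
    then have "D (p - q) = D p - D q" by (rule derivation_diff[OF sub D])
    then show ?case using diff subring_diff[OF is_subring_adjoin] by metis
  next
    case (mult p q)
    then have "p \<in> ?A" "q \<in> ?A" using CA C_def by auto
    then have "D (p * q) = p * D q + D p * q" by (rule derivation_mult[OF D])
    then show ?case
      using mult subring_add[OF is_subring_adjoin] subring_mult[OF is_subring_adjoin] by metis
  next
    case (base r)
    then show ?case using DR C C_def subring_zero by auto
  next
    case (generator s)
    then show ?case using DXC C_def by auto
  qed
  have DonC: "derivation_on C D"
    using D DC CA unfolding derivation_on_def by blast
  have \<delta>D: "D (\<delta> n p) = \<delta> n (D p)" if "p \<in> ?A" for p
  proof (rule derivations_commute[of constants "X ` {1..n}", unfolded A])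
    show "D (\<delta> n s) = \<delta> n (D s)" if "s \<in> X ` {1..n}" for s
      using that \<delta>(3)[OF n(1)] \<delta>C[OF DXC] derivation_zero[OF sub D] derivation_one[OF sub D]
      by auto
  qed (use that one_in_constants D DR \<delta> n in auto)
  \<comment> \<open>It suffices to find an element of the kernel of \<open>D\<close> that \<open>\<delta> n\<close> does not kill.\<close>
  note via_\<delta>n = kernel_not_rigid[OF sub D \<delta>_LND[OF n(1)] \<delta>D]

  consider (lower) "\<exists>c\<in>C. D c \<noteq> 0" | (zero) "D (X n) = 0"
    | (last) "\<forall>c\<in>C. D c = 0" "D (X n) \<noteq> 0" by blast
  then show ?thesis
  proof cases
    case lower
    have nil: "\<exists>m. (D ^^ m) c = 0" if "c \<in> C" for c
      using LND CA that unfolding LND_def by blast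
    then obtain r where r: "r \<in> C" "D r \<noteq> 0" "D (D r) = 0"
      using lower local_slice_exists[OF C DonC] by metis
    have char: "CHAR('r mpoly) = 0"
      unfolding CHAR_eq0_iff
    proof (intro allI impI notI)
      fix k :: nat assume "k > 0" "of_nat k = (0 :: 'r mpoly)"
      then have "Poly_Mapping.lookup (of_nat k :: 'r mpoly) 0 = 0" by simp
      then have "of_nat k = (0 :: 'r)" by (simp add: lookup_of_nat)
      then show False using \<open>k > 0\<close> assms(2) CHAR_eq0_iff by blast
    qed
    obtain m where m: "(D ^^ m) (D (X n)) = 0" using nil[OF DXC[OF n(1)]] ..
    \<comment> \<open>The antiderivative of \<open>D (X n)\<close>, taken with exponent \<open>j = 0\<close> of the slice.\<close>
    obtain c u where cu: "c \<in> C" "u \<in> C" "u \<noteq> 0" "D u = 0" "D c = u * D (X n)"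
      using local_slice_antiderivative[OF C DonC char r DXC[OF n(1)] m, of 0] by auto
    have uA: "u \<in> ?A" "c \<in> ?A" "u * X n \<in> ?A"
      using cu CA XA n sub by (auto intro: subring_mult)
    show ?thesis
    proof (rule via_\<delta>n)
      show "u * X n - c \<in> ?A" using uA sub by (simp add: subring_diff)
      show "D (u * X n - c) = 0"
        using uA cu XA[OF n(1)] by (simp add: derivation_diff[OF sub D] derivation_mult[OF D])
      have "\<delta> n (u * X n - c) = u"
        using uA \<delta>C cu \<delta>(3)[OF n(1,1)] XA[OF n(1)] \<delta>(1)[OF n(1)]
        by (simp add: derivation_diff[OF sub \<delta>(1)[OF n(1)]] derivation_mult[OF \<delta>(1)[OF n(1)]])
      then show "\<delta> n (u * X n - c) \<noteq> 0" using cu by simp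
    qed
  next
    case zero
    then show ?thesis
      using \<delta>(3)[OF n(1,1)] XA[OF n(1)] by (intro via_\<delta>n) auto
  next
    case last
    let ?f = "D (X n)"
    have f: "?f \<in> ?A" using DXC n CA by blast
    have XC: "X i \<in> C" if "i \<in> {1..n}" "i \<noteq> n" for i
      unfolding C_def using that by (intro adjoin_generator) auto
    have D_eq: "D p = ?f * \<delta> n p" if "p \<in> ?A" for p
    proof (rule derivations_agree[of constants "X ` {1..n}" D "\<lambda>p. ?f * \<delta> n p", unfolded A])
      show "D s = ?f * \<delta> n s" if "s \<in> X ` {1..n}" for s
        using that \<delta>(3)[OF n(1)] last(1) XC by auto
    qed (use that one_in_constants D DR \<delta> n derivation_scale[OF sub _ f] in auto)
    \<comment> \<open>\<open>\<delta> n\<close> vanishes on the kernel of \<open>D\<close>, so another partial derivative takes its place.\<close>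
    then have ker: "ker_on ?A D = ker_on ?A (\<delta> n)"
      using last(2) by (auto simp: ker_on_def)
    have comm: "\<delta> n (\<delta> 1 p) = \<delta> 1 (\<delta> n p)" if "p \<in> ?A" for p
    proof (rule derivations_commute[of constants "X ` {1..n}", unfolded A])
      show "\<delta> n (\<delta> 1 s) = \<delta> 1 (\<delta> n s)" if "s \<in> X ` {1..n}" for s
        using that \<delta>(3)[OF n(1)] \<delta>(3)[OF n(2)] derivation_zero[OF sub \<delta>(1)]
          derivation_one[OF sub \<delta>(1)] n by auto
    qed (use that one_in_constants \<delta> n in auto)
    show ?thesis
      unfolding ker
    proof (rule kernel_not_rigid[OF sub \<delta>(1)[OF n(1)] \<delta>_LND[OF n(2)] comm XA[OF n(2)]])
      show "\<delta> n (X 1) = 0" "\<delta> 1 (X 1) \<noteq> 0"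
        using \<delta>(3)[OF n(1,2)] \<delta>(3)[OF n(2,2)] n(3) by auto
    qed
  qed
qed

end
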